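(* Let $n\ge 1$ be an integer (the number of periods), let $r>0$ be the constant per-period continuously compounded risk-free rate, and let $\bar y\in\mathbb{R}$ be the mean per-period log return of the market over the $n$ periods, with $\bar y>r$. Then, per unit of initial capital, the terminal difference between the buy-and-hold market and the buy-and-hold risk-free asset is strictly larger than the terminal difference between the hypothetical buy-and-hold excess-market asset and the hypothetical buy-and-hold zero-rate asset; that is, $$e^{n\bar y}-e^{nr}>e^{n(\bar y-r)}-e^{0}.$$
   Context: For a buy-and-hold price process $S_0,S_1,\dots,S_n>0$, the log return in period $t$ is $y_t=\ln(S_t/S_{t-1})$, and the mean log return is $\bar y=\frac1n\sum_{t=1}^n y_t=\frac1n\ln(S_n/S_0)$, so one unit of capital held in the asset for $n$ periods grows to $e^{n\bar y}$. One unit held in the risk-free asset at constant rate $r$ grows to $e^{nr}$. The hypothetical excess-market asset grows at mean log return $\bar y-r$ (so one unit grows to $e^{n(\bar y-r)}$), and the hypothetical zero-rate asset grows at rate $0$ (so one unit stays at $e^0=1$). The quantity $e^{n\bar y}-e^{nr}$ is called MmTb and $e^{n(\bar y-r)}-e^{0}$ is called XmFv. *)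

theory Defs
  imports Complex_Main
begin

definition log_return :: "(nat \<Rightarrow> real) \<Rightarrow> nat \<Rightarrow> real" where
  "log_return S t = ln (S t / S (t - 1))"

definition mean_log_return :: "(nat \<Rightarrow> real) \<Rightarrow> nat \<Rightarrow> real" where
  "mean_log_return S n = (\<Sum>t = 1..n. log_return S t) / real n"

definition terminal_value :: "nat \<Rightarrow> real \<Rightarrow> real" where
  "terminal_value n g = exp (real n * g)"

text \<open>
  Terminal differences per unit of initial capital: buy-and-hold market minus
  buy-and-hold risk-free asset (MmTb), and hypothetical excess-market asset minus
  hypothetical zero-rate asset (XmFv).
\<close>

definition MmTb :: "nat \<Rightarrow> real \<Rightarrow> real \<Rightarrow> real" where
  "MmTb n ybar r = terminal_value n ybar - terminal_value n r"

definition XmFv :: "nat \<Rightarrow> real \<Rightarrow> real \<Rightarrow> real" where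
  "XmFv n ybar r = terminal_value n (ybar - r) - terminal_value n 0"

lemma sum_log_return:
  assumes "\<And>t. t \<le> n \<Longrightarrow> S t > 0"
  shows "(\<Sum>t = 1..n. log_return S t) = ln (S n / S 0)"
  using assms
proof (induction n)
  case 0
  then show ?case by simp
next
  case (Suc n)
  have "S 0 > 0" "S n > 0" "S (Suc n) > 0" using Suc.prems by auto
  then have "ln (S n / S 0) + log_return S (Suc n) = ln (S (Suc n) / S 0)"
    by (simp add: log_return_def ln_div)
  with Suc show ?case by simp
qed

text \<open>
  Holding one unit of capital in an asset with prices \<open>S\<close> for \<open>n\<close> periods yields
  \<open>S n / S 0\<close>, which is what \<^const>\<open>terminal_value\<close> computes from the mean log return.
\<close>

lemma terminal_value_mean_log_return:
  assumes "n \<ge> 1" "\<And>t. t \<le> n \<Longrightarrow> S t > 0"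
  shows "terminal_value n (mean_log_return S n) = S n / S 0"
proof -
  have "S 0 > 0" "S n > 0" using assms(2) by auto
  then show ?thesis
    using assms(1) sum_log_return[of n S, OF assms(2)]
    by (simp add: terminal_value_def mean_log_return_def)
qed

text \<open>Every real number is the mean log return of some positive price process.\<close>

lemma mean_log_return_exp:
  assumes "n \<ge> 1"
  shows "mean_log_return (\<lambda>t. exp (real t * g)) n = g"
  using assms sum_log_return[of n "\<lambda>t. exp (real t * g)"]
  by (simp add: mean_log_return_def)

end

theory Submission
  imports Defs
begin

text \<open>Factoring \<open>exp (real n * r)\<close> out of the market difference leaves exactly
  the excess-market difference, because \<open>terminal_value n 0\<close> is 1. The claim thus
  reduces to the fact that multiplying a positive number by a factor above 1 strictly enlarges
  it.\<close>

lemma MmTb_eq_exp_mult_XmFv: "MmTb n ybar r = exp (real n * r) * XmFv n ybar r"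
  by (simp add: MmTb_def XmFv_def terminal_value_def algebra_simps flip: exp_add)

theorem proposition2:
  fixes S :: "nat \<Rightarrow> real" and n :: nat and r ybar :: real
  assumes "n \<ge> 1"
    and "\<And>t. t \<le> n \<Longrightarrow> S t > 0"
    and "ybar = mean_log_return S n"
    and "r > 0"
    and "ybar > r"
  shows "MmTb n ybar r > XmFv n ybar r"
proof -
  \<comment> \<open>The sign matters: a factor above 1 would shrink a negative difference further.
    Here \<open>n \<ge> 1\<close> and \<open>ybar > r\<close> make the exponent positive.\<close>
  have "XmFv n ybar r > 0"
    using assms(1,5) by (simp add: XmFv_def terminal_value_def)
  moreover have "exp (real n * r) > 1"
    using assms(1,4) by simp
  ultimately show ?thesis
    by (simp add: MmTb_eq_exp_mult_XmFv)
qed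

end
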